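(* Let $k\ge 2$ and $m\ge 1$ be fixed integers and let $\Sigma$ be an alphabet with $m$ letters. The number of $k$-abelian equivalence classes of words of length $n$ over $\Sigma$ that contain exactly one word is of order $\mathcal{O}\left(n^{N_m(k-1)-1}\right)$ as $n\to\infty$, where $$N_m(l)=\frac{1}{l}\sum_{d\mid l}\varphi(d)\,m^{l/d}.$$
   Context: For a word $u$ and a non-empty word $x$ over a finite alphabet $\Sigma$, $|u|_x$ denotes the number of occurrences (overlapping ones included) of $x$ as a factor (contiguous subword) of $u$. Two words $u,v\in\Sigma^*$ are $k$-abelian equivalent, $u\sim_k v$, if $|u|_x=|v|_x$ for every non-empty word $x\in\Sigma^*$ of length at most $k$ (so $k$-abelian equivalent words have equal length). The $k$-abelian class of $u$ is $[u]_k=\{v\in\Sigma^*: v\sim_k u\}$. $\varphi$ is Euler's totient function; $N_m(l)$ is the number of necklaces (conjugacy classes of words) of length $l$ over an $m$-letter alphabet. *)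

theory Defs
  imports Complex_Main "HOL-Library.Landau_Symbols" "HOL-Number_Theory.Totient"
begin

text \<open>Words are lists; the words over an alphabet \<open>\<Sigma>\<close> are the elements of \<open>lists \<Sigma>\<close>.\<close>

text \<open>Occurrences are counted by their starting positions, so overlapping ones are all counted.\<close>

definition occurrences :: "'a list \<Rightarrow> 'a list \<Rightarrow> nat" where
  "occurrences u x = card {i. i + length x \<le> length u \<and> take (length x) (drop i u) = x}"

definition k_abelian_equiv :: "'a set \<Rightarrow> nat \<Rightarrow> 'a list \<Rightarrow> 'a list \<Rightarrow> bool" where
  "k_abelian_equiv \<Sigma> k u v \<longleftrightarrow>
     (\<forall>x \<in> lists \<Sigma>. x \<noteq> [] \<and> length x \<le> k \<longrightarrow> occurrences u x = occurrences v x)"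

definition k_abelian_class :: "'a set \<Rightarrow> nat \<Rightarrow> 'a list \<Rightarrow> 'a list set" where
  "k_abelian_class \<Sigma> k u = {v \<in> lists \<Sigma>. k_abelian_equiv \<Sigma> k v u}"

definition k_abelian_classes :: "'a set \<Rightarrow> nat \<Rightarrow> nat \<Rightarrow> 'a list set set" where
  "k_abelian_classes \<Sigma> k n = {k_abelian_class \<Sigma> k u |u. u \<in> lists \<Sigma> \<and> length u = n}"

definition singleton_classes :: "'a set \<Rightarrow> nat \<Rightarrow> nat \<Rightarrow> 'a list set set" where
  "singleton_classes \<Sigma> k n = {C \<in> k_abelian_classes \<Sigma> k n. card C = 1}"

text \<open>The number \<open>N\<^sub>m(l)\<close> of necklaces of length \<open>l \<ge> 1\<close> over \<open>m\<close> letters, given by its closed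
  formula. It is real-valued, so neither the division by \<open>l\<close> nor a later subtraction truncates.\<close>

definition necklace_number :: "nat \<Rightarrow> nat \<Rightarrow> real" where
  "necklace_number m l = 1 / real l * (\<Sum>d | d dvd l. real (totient d) * real m ^ (l div d))"

end

theory Submission
  imports Defs "HOL-Library.FuncSet"
begin

text \<open>
  Put \<open>l = k - 1\<close>. A word is a walk in the de Bruijn graph whose vertices are the words
  of length \<open>l\<close> and whose edges are the words of length \<open>k\<close>; its
  \<open>k\<close>-abelian class is determined by the end point of the walk and by how often the
  walk uses each edge. Two consecutive closed walks at a vertex may be exchanged without leaving the
  class, so in a word that is alone in its class they commute
  (\<open>windows_rigid_of_singleton_class\<close>). It follows that all loops between successive
  visits to a vertex are equal, and that a vertex visited at least three times is visited almost as
  often as every vertex on its loop.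

  Let \<open>S\<close> be a set of vertices that meets every closed walk. Then every edge is used at
  most twice or, up to an error of at most 2, as often as some vertex of \<open>S\<close> is visited
  (\<open>visits_near_transversal\<close>, \<open>singleton_counts_near_transversal\<close>). A
  singleton word is thus determined by data from a finite set that does not depend on
  \<open>n\<close>, together with the numbers of visits to the elements of \<open>S\<close>; and one
  of these numbers follows from the others, because the length is given. This leaves \<open>O(n ^
  (card S - 1))\<close> words (\<open>card_singleton_words_le\<close>).

  It remains to find \<open>S\<close> with at most one element in each necklace. This is
  Mykkeltveit's theorem (\<open>necklace_transversal\<close>): the letters of a word are regarded as
  masses at the \<open>l\<close>-th roots of unity. Along an edge the moment of the masses moves
  horizontally and then turns clockwise, while over a closed walk the moments sum to 0. So the
  moment crosses the positive real axis downwards somewhere, or else the walk only rotates a word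
  with moment 0. The closed formula for the number of necklaces is Burnside's counting
  (\<open>card_necklaces\<close>).
\<close>

section \<open>Walks whose consecutive loops commute\<close>

text \<open>What remains of the singleton condition once words are read as walks: if \<open>a < b \<le> d\<close> are
  visits to one vertex, exchanging the closed walks \<open>a..b\<close> and \<open>b..d\<close> must not change the walk,
  so the walk from \<open>a\<close> agrees with the one from \<open>b\<close> for \<open>d - b\<close> steps.\<close>

definition loop_rigid :: "(nat \<Rightarrow> 'b) \<Rightarrow> nat \<Rightarrow> bool" where
  "loop_rigid x N \<longleftrightarrow> (\<forall>a b d e. a < b \<and> b \<le> d \<and> d \<le> N \<and> x a = x b \<and> x b = x d \<and> e \<le> d - b
     \<longrightarrow> x (a + e) = x (b + e))"

definition visits :: "(nat \<Rightarrow> 'b) \<Rightarrow> nat \<Rightarrow> 'b \<Rightarrow> nat set" where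
  "visits x N v = {t. t \<le> N \<and> x t = v}"

definition first_return :: "(nat \<Rightarrow> 'b) \<Rightarrow> nat \<Rightarrow> nat \<Rightarrow> bool" where
  "first_return x p q \<longleftrightarrow> p < q \<and> x q = x p \<and> (\<forall>t. p < t \<and> t < q \<longrightarrow> x t \<noteq> x p)"

lemma finite_visits [simp]: "finite (visits x N v)"
  unfolding visits_def by simp

lemma loop_rigidD:
  assumes "loop_rigid x N" "a < b" "b \<le> d" "d \<le> N" "x a = x b" "x b = x d" "e \<le> d - b"
  shows "x (a + e) = x (b + e)"
  using assms unfolding loop_rigid_def by blast

lemma first_return_exists:
  assumes "p < r" "x r = x p"
  obtains q where "first_return x p q" "q \<le> r"
proof -
  define q where "q = (LEAST t. p < t \<and> x t = x p)"
  have "p < q \<and> x q = x p"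
    unfolding q_def by (rule LeastI[of _ r]) (use assms in simp)
  moreover have "x t \<noteq> x p" if "p < t" "t < q" for t
    using not_less_Least[of t "\<lambda>t. p < t \<and> x t = x p"] that unfolding q_def by auto
  moreover have "q \<le> r"
    unfolding q_def by (rule Least_le) (use assms in simp)
  ultimately show thesis
    using that unfolding first_return_def by blast
qed

text \<open>All first-return loops at a vertex are equal. Rigidity makes the two loops agree for as long as
  the later one lasts; if one of them were shorter, its return would be a premature return inside
  the other.\<close>

lemma loops_agree_ordered:
  assumes "loop_rigid x N" "first_return x p p'" "first_return x q q'"
    "x p = x q" "p < q" "q' \<le> N"
  shows "q' - q = p' - p \<and> (\<forall>e \<le> p' - p. x (p + e) = x (q + e))"
proof -
  have p: "p < p'" "x p' = x p" "\<And>t. p < t \<Longrightarrow> t < p' \<Longrightarrow> x t \<noteq> x p"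
    and q: "q < q'" "x q' = x q" "\<And>t. q < t \<Longrightarrow> t < q' \<Longrightarrow> x t \<noteq> x q"
    using assms(2,3) by (simp_all add: first_return_def)
  have agree: "x (p + e) = x (q + e)" if "e \<le> q' - q" for e
    by (rule loop_rigidD[OF assms(1) \<open>p < q\<close> _ \<open>q' \<le> N\<close> assms(4) q(2)[symmetric] that])
      (use q(1) in simp)
  have "\<not> q' - q < p' - p"
  proof
    assume less: "q' - q < p' - p"
    have "x (p + (q' - q)) = x p"
      using agree[of "q' - q"] q(1,2) assms(4) by simp
    moreover have "p < p + (q' - q)" "p + (q' - q) < p'"
      using less q(1) by linarith+
    ultimately show False
      using p(3) by blast
  qed
  moreover have "\<not> p' - p < q' - q"
  proof
    assume less: "p' - p < q' - q"
    have "x (q + (p' - p)) = x q"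
      using agree[of "p' - p"] less p(1,2) assms(4) by simp
    moreover have "q < q + (p' - p)" "q + (p' - p) < q'"
      using less p(1) by linarith+
    ultimately show False
      using q(3) by blast
  qed
  ultimately show ?thesis
    using agree by auto
qed

lemma loops_agree:
  assumes "loop_rigid x N" "first_return x p p'" "first_return x q q'"
    "x p = x q" "p' \<le> N" "q' \<le> N" "e \<le> p' - p"
  shows "q' - q = p' - p" "x (q + e) = x (p + e)"
proof -
  consider "p < q" | "q < p" | "p = q" by linarith
  then have "q' - q = p' - p \<and> x (q + e) = x (p + e)"
  proof cases
    case 1
    then show ?thesis
      using loops_agree_ordered[OF assms(1-4)] assms by auto
  next
    case 2
    then show ?thesis
      using loops_agree_ordered[OF assms(1,3,2)] assms by auto
  next
    case 3
    then have "q' = p'"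
      using assms(2,3) unfolding first_return_def by (metis linorder_neqE_nat)
    then show ?thesis
      using 3 by simp
  qed
  then show "q' - q = p' - p" "x (q + e) = x (p + e)" by auto
qed

text \<open>Each visit to a vertex except the last opens a copy of the same loop, and each copy visits every
  vertex of that loop at the same offset.\<close>

lemma visits_le_of_loop:
  assumes "loop_rigid x N" "first_return x p p'" "p' \<le> N" "f \<le> p' - p"
  shows "card (visits x N (x p)) \<le> card (visits x N (x (p + f))) + 1"
proof -
  let ?V = "visits x N (x p)"
  define z where "z = Max ?V"
  have "p \<in> ?V"
    using assms(2,3) unfolding visits_def first_return_def by simp
  then have z: "z \<in> ?V"
    unfolding z_def by (intro Max_in) auto
  have "(\<lambda>q. q + f) ` (?V - {z}) \<subseteq> visits x N (x (p + f))"
  proof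
    fix y assume "y \<in> (\<lambda>q. q + f) ` (?V - {z})"
    then obtain q where q: "y = q + f" "q \<in> ?V" "q \<noteq> z" by auto
    have "q \<le> z"
      unfolding z_def using q(2) by (intro Max_ge) auto
    with q(3) have "q < z" by simp
    moreover have "x z = x q"
      using z q by (simp add: visits_def)
    ultimately obtain q' where q': "first_return x q q'" "q' \<le> z"
      using first_return_exists[of q z x] \<open>q < z\<close> by auto
    have "q' \<le> N"
      using q' z by (simp add: visits_def)
    moreover have "x p = x q"
      using q by (simp add: visits_def)
    ultimately have "q' - q = p' - p" "x (q + f) = x (p + f)"
      using loops_agree[OF assms(1,2) q'(1)] assms(3,4) by auto
    moreover have "q + f \<le> N"
    proof -
      have "q < q'"
        using q'(1) by (simp add: first_return_def)
      then show ?thesis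
        using calculation(1) assms(4) \<open>q' \<le> N\<close> by linarith
    qed
    ultimately show "y \<in> visits x N (x (p + f))"
      using q by (simp add: visits_def)
  qed
  then have "card ((\<lambda>q. q + f) ` (?V - {z})) \<le> card (visits x N (x (p + f)))"
    by (intro card_mono) auto
  moreover have "card ((\<lambda>q. q + f) ` (?V - {z})) = card ?V - 1"
    using z by (subst card_image) (auto simp: inj_on_def)
  ultimately show ?thesis by simp
qed

text \<open>The loop at a vertex \<open>v\<close> visited three times meets \<open>S\<close>, say in \<open>s\<close>. One inequality comes from the
  visits to \<open>s\<close> on the loops at \<open>v\<close>. For the other one, a loop at \<open>s\<close> that passes through \<open>v\<close> is
  needed; two loops at \<open>v\<close> (hence the three visits) contain \<open>s\<close> twice with \<open>v\<close> in between.\<close>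

lemma visits_near_transversal:
  assumes rigid: "loop_rigid x N"
    and hit: "\<And>a b. a < b \<Longrightarrow> b \<le> N \<Longrightarrow> x a = x b \<Longrightarrow> \<exists>t. a \<le> t \<and> t < b \<and> x t \<in> S"
    and three: "card (visits x N v) \<ge> 3"
  shows "\<exists>s \<in> S. card (visits x N v) \<le> card (visits x N s) + 1
                \<and> card (visits x N s) \<le> card (visits x N v) + 1"
proof -
  let ?V = "visits x N v"
  define a where "a = Min ?V"
  define z where "z = Max ?V"
  have "?V \<noteq> {}" using three by auto
  then have a: "a \<in> ?V" and z: "z \<in> ?V"
    unfolding a_def z_def by auto
  have "?V - {a, z} \<noteq> {}"
  proof
    assume "?V - {a, z} = {}"
    then have "card ?V \<le> card {a, z}"
      by (intro card_mono) auto
    then show False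
      using three by (simp add: card_insert_if split: if_splits)
  qed
  then obtain y where y: "y \<in> ?V" "y \<noteq> a" "y \<noteq> z" by auto
  have "a \<le> y" "y \<le> z"
    unfolding a_def z_def using y(1) by (auto intro: Min_le Max_ge)
  with y have ay: "a < y" "y < z" by simp_all
  have xs: "x a = v" "x y = v" "x z = v" "z \<le> N"
    using a y z by (auto simp: visits_def)
  obtain b where b: "first_return x a b" "b \<le> y"
    using first_return_exists[of a y x] ay xs by auto
  then have xb: "x b = v" "a < b"
    using xs by (auto simp: first_return_def)
  obtain c where c: "first_return x b c" "c \<le> z"
    using first_return_exists[of b z x] ay xs b xb by auto
  obtain t0 where t0: "a \<le> t0" "t0 < b" "x t0 \<in> S"
    using hit[of a b] xb xs b ay by auto
  define s where "s = x t0"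
  \<comment> \<open>the last visit to \<open>s\<close> inside the loop, so that the next one does not come before \<open>b\<close>\<close>
  define p where "p = Max {t. a \<le> t \<and> t < b \<and> x t = s}"
  have fin: "finite {t. a \<le> t \<and> t < b \<and> x t = s}"
    by simp
  have p: "a \<le> p" "p < b" "x p = s"
  proof -
    have "p \<in> {t. a \<le> t \<and> t < b \<and> x t = s}"
      unfolding p_def using t0 by (intro Max_in[OF fin]) (auto simp: s_def)
    then show "a \<le> p" "p < b" "x p = s" by auto
  qed
  have p_last: "x t \<noteq> s" if "p < t" "t < b" for t
  proof
    assume "x t = s"
    then have "t \<le> p"
      unfolding p_def using that p(1) by (intro Max_ge[OF fin]) auto
    with that(1) show False by simp
  qed
  have bc: "c - b = b - a" "x (b + (p - a)) = s"
    using loops_agree[OF rigid b(1) c(1), of "p - a"] b c xs xb ay p by auto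
  obtain p' where p': "first_return x p p'" "p' \<le> b + (p - a)"
    by (rule first_return_exists[of p "b + (p - a)" x]) (use p bc xb in auto)
  have "b \<le> p'"
  proof (rule ccontr)
    assume "\<not> b \<le> p'"
    then show False
      using p_last[of p'] p'(1) p(3) unfolding first_return_def by auto
  qed
  have "p' \<le> N"
    using p'(2) bc(1) c(2) xs(4) xb(2) p(1) p(2) by linarith
  have "card ?V \<le> card (visits x N s) + 1"
    using visits_le_of_loop[OF rigid b(1), of "p - a"] p b ay xs by simp
  moreover have "card (visits x N s) \<le> card ?V + 1"
    using visits_le_of_loop[OF rigid p'(1) \<open>p' \<le> N\<close>, of "b - p"] p \<open>b \<le> p'\<close> xb by simp
  ultimately show ?thesis
    using t0 s_def by blast
qed

text \<open>A vertex visited at least three times is left along the same edge at every visit but the last, by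
  rigidity with offset 1. So an edge traversed more than twice is traversed about as often as its
  source is visited.\<close>

lemma transitions_near_transversal:
  fixes v w :: 'b
  assumes rigid: "loop_rigid x N"
    and hit: "\<And>a b. a < b \<Longrightarrow> b \<le> N \<Longrightarrow> x a = x b \<Longrightarrow> \<exists>t. a \<le> t \<and> t < b \<and> x t \<in> S"
  defines "C \<equiv> {t. t < N \<and> x t = v \<and> x (Suc t) = w}"
  shows "card C \<le> 2 \<or>
         (\<exists>s \<in> S. card C \<le> card (visits x N s) + 2 \<and> card (visits x N s) \<le> card C + 2)"
proof -
  let ?V = "visits x N v"
  have "C \<subseteq> ?V"
    unfolding C_def visits_def by auto
  then have CV: "card C \<le> card ?V"
    by (intro card_mono) auto
  show ?thesis
  proof (cases "card C \<le> 2")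
    case False
    then have three: "card ?V \<ge> 3"
      using CV by simp
    define z where "z = Max ?V"
    have "?V \<noteq> {}" using three by auto
    then have z: "z \<in> ?V"
      unfolding z_def by auto
    have "\<not> C \<subseteq> {z}"
      using False card_mono[of "{z}" C] by auto
    then obtain t where t: "t \<in> C" "t \<noteq> z" by auto
    have lt: "t' < z" if "t' \<in> ?V" "t' \<noteq> z" for t'
    proof -
      have "t' \<le> z"
        unfolding z_def using that(1) by (intro Max_ge) auto
      with that(2) show ?thesis by simp
    qed
    have tz: "t < z"
      using lt t \<open>C \<subseteq> ?V\<close> by blast
    have "?V - {z} \<subseteq> C"
    proof
      fix t' assume t': "t' \<in> ?V - {z}"
      then have t'z: "t' < z"
        using lt by blast
      have eqs: "x t = v" "x t' = v" "x z = v" "z \<le> N" "x (Suc t) = w"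
        using t t' z by (auto simp: C_def visits_def)
      consider "t < t'" | "t' < t" | "t' = t" by linarith
      then have "x (Suc t') = w"
      proof cases
        case 1
        then show ?thesis
          using loop_rigidD[OF rigid, of t t' z 1] t'z eqs by simp
      next
        case 2
        then show ?thesis
          using loop_rigidD[OF rigid, of t' t z 1] tz eqs by simp
      qed (use eqs in simp)
      then show "t' \<in> C"
        using eqs t'z unfolding C_def by simp
    qed
    moreover have "finite C"
      unfolding C_def by simp
    ultimately have "card (?V - {z}) \<le> card C"
      by (intro card_mono)
    then have "card ?V \<le> card C + 1"
      using z by simp
    moreover obtain s where "s \<in> S" "card ?V \<le> card (visits x N s) + 1"
        "card (visits x N s) \<le> card ?V + 1"
      using visits_near_transversal[of x N S v] rigid hit three by blast
    ultimately show ?thesis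
      using CV by (intro disjI2 bexI[of _ s]) auto
  qed simp
qed

section \<open>Words as walks in the de Bruijn graph\<close>

lemma occurrences_Nil [simp]: "occurrences [] x = (if x = [] then 1 else 0)"
proof -
  have "{i. i + length x \<le> length [] \<and> take (length x) (drop i []) = x} = (if x = [] then {0} else {})"
    by auto
  then show ?thesis
    unfolding occurrences_def by simp
qed

lemma occurrences_Cons:
  "occurrences (a # u) x = (if take (length x) (a # u) = x then 1 else 0) + occurrences u x"
proof -
  let ?M = "\<lambda>u. {i. i + length x \<le> length u \<and> take (length x) (drop i u) = x}"
  let ?Z = "if take (length x) (a # u) = x then {0::nat} else {}"
  have "length x \<le> length (a # u)" if "take (length x) (a # u) = x"
    using arg_cong[OF that, of length] by simp
  then have split: "?M (a # u) = ?Z \<union> Suc ` ?M u"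
    by (intro set_eqI, case_tac xa) auto
  have "finite (?M u)"
    by (rule finite_subset[of _ "{..length u}"]) auto
  then have "card (?M (a # u)) = card ?Z + card (Suc ` ?M u)"
    unfolding split by (intro card_Un_disjoint) auto
  then show ?thesis
    unfolding occurrences_def by (simp add: card_image)
qed

text \<open>An occurrence of \<open>x\<close> that starts in \<open>p\<close> reaches at most \<open>l\<close> letters into \<open>r\<close>; the two correction
  terms keep the identity free of subtraction.\<close>

lemma occurrences_append:
  assumes "length x \<le> Suc l" "l \<le> length r"
  shows "occurrences (p @ r) x + occurrences (take l r) x = occurrences (p @ take l r) x + occurrences r x"
proof (induction p)
  case (Cons a p)
  have "take (length x) (a # p @ r) = take (length x) (a # p @ take l r)"
    using assms by (cases "length x") (auto simp: min_def)
  then show ?case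
    using Cons by (simp add: occurrences_Cons)
qed simp

lemma take_append_cong:
  assumes "take l r = take l r'"
  shows "take l (p @ r) = take l (p @ r')"
proof -
  have "take (l - length p) r = take (l - length p) (take l r)" for r :: "'a list"
    by (simp add: min_def)
  then show ?thesis
    using assms by (metis take_append)
qed

text \<open>The words \<open>a\<close> and \<open>c\<close> label consecutive closed walks at the vertex \<open>take l d\<close>, so they may be
  exchanged: each of \<open>p\<close>, \<open>a\<close> and \<open>c\<close> is still followed by the same \<open>l\<close> letters.\<close>

lemma occurrences_exchange_loops:
  assumes "length x \<le> Suc l" "l \<le> length d"
    and "take l (a @ c @ d) = take l d" "take l (c @ d) = take l d"
  shows "occurrences (p @ c @ a @ d) x = occurrences (p @ a @ c @ d) x"
    and "take l (a @ d) = take l d"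
proof -
  define v where "v = take l d"
  have ad: "take l (a @ d) = v"
    using take_append_cong[OF assms(4), of a] assms(3) v_def by simp
  have cad: "take l (c @ a @ d) = v"
    using take_append_cong[of l "a @ d" d c] ad assms(4) v_def by simp
  have acd: "take l (a @ c @ d) = v" and cd: "take l (c @ d) = v"
    using assms(3,4) v_def by simp_all
  note app = occurrences_append[OF assms(1)]
  have "occurrences (p @ c @ a @ d) x + occurrences v x
      = occurrences (p @ v) x + occurrences (c @ a @ d) x"
    using app[of "c @ a @ d" p] cad assms(2) by simp
  moreover have "occurrences (c @ a @ d) x + occurrences v x
      = occurrences (c @ v) x + occurrences (a @ d) x"
    using app[of "a @ d" c] ad assms(2) by simp
  moreover have "occurrences (a @ d) x + occurrences v x
      = occurrences (a @ v) x + occurrences d x"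
    using app[of d a] assms(2) by (simp add: v_def)
  moreover have "occurrences (p @ a @ c @ d) x + occurrences v x
      = occurrences (p @ v) x + occurrences (a @ c @ d) x"
    using app[of "a @ c @ d" p] acd assms(2) by simp
  moreover have "occurrences (a @ c @ d) x + occurrences v x
      = occurrences (a @ v) x + occurrences (c @ d) x"
    using app[of "c @ d" a] cd assms(2) by simp
  moreover have "occurrences (c @ d) x + occurrences v x
      = occurrences (c @ v) x + occurrences d x"
    using app[of d c] assms(2) by (simp add: v_def)
  ultimately show "occurrences (p @ c @ a @ d) x = occurrences (p @ a @ c @ d) x"
    by linarith
  show "take l (a @ d) = take l d"
    using ad v_def by simp
qed

definition window :: "nat \<Rightarrow> 'a list \<Rightarrow> nat \<Rightarrow> 'a list" where
  "window l u t = take l (drop t u)"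

text \<open>The word obtained by exchanging two consecutive closed walks is \<open>k\<close>-abelian equivalent to \<open>u\<close>, so
  it is \<open>u\<close> itself, and comparing the windows of both factorizations gives rigidity.\<close>

lemma windows_rigid_of_singleton_class:
  assumes "u \<in> lists \<Sigma>" "l \<le> length u" "k_abelian_class \<Sigma> (Suc l) u = {u}"
  shows "loop_rigid (window l u) (length u - l)"
  unfolding loop_rigid_def
proof (intro allI impI, elim conjE)
  fix i j q e
  assume ij: "i < j" "j \<le> q" "q \<le> length u - l" "e \<le> q - j"
    and eq: "window l u i = window l u j" "window l u j = window l u q"
  define p where "p = take i u"
  define a where "a = take (j - i) (drop i u)"
  define c where "c = take (q - j) (drop j u)"
  define d where "d = drop q u"
  have cd: "drop j u = c @ d"
    using append_take_drop_id[of "q - j" "drop j u"] ij unfolding c_def d_def by simp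
  have acd: "drop i u = a @ c @ d"
    using append_take_drop_id[of "j - i" "drop i u"] ij unfolding a_def cd[symmetric] by simp
  have u: "u = p @ a @ c @ d"
    unfolding p_def acd[symmetric] by simp
  have len: "l \<le> length d" "length c = q - j"
    unfolding c_def d_def using ij assms(2) by auto
  have v: "take l (a @ c @ d) = take l d" "take l (c @ d) = take l d"
    using eq unfolding window_def acd cd d_def by auto
  have "k_abelian_equiv \<Sigma> (Suc l) (p @ c @ a @ d) u"
    unfolding k_abelian_equiv_def u using occurrences_exchange_loops(1)[OF _ len(1) v] by auto
  moreover have "p @ c @ a @ d \<in> lists \<Sigma>"
    using assms(1) unfolding u by simp
  ultimately have "p @ c @ a @ d \<in> k_abelian_class \<Sigma> (Suc l) u"
    unfolding k_abelian_class_def by simp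
  then have "p @ c @ a @ d = p @ a @ c @ d"
    using assms(3) u by auto
  then have comm: "a @ c @ d = c @ a @ d" by simp
  have "window l u (i + e) = take l (drop e (a @ c @ d))"
    unfolding window_def acd[symmetric] by (simp add: add.commute)
  also have "\<dots> = take l (drop e c @ a @ d)"
    using ij len unfolding comm by simp
  also have "\<dots> = take l (drop e c @ d)"
    using occurrences_exchange_loops(2)[OF _ len(1) v, of "[]"] by (intro take_append_cong) simp
  also have "\<dots> = window l u (j + e)"
    using arg_cong[OF cd, of "drop e"] ij(4) len(2) unfolding window_def by (simp add: add.commute)
  finally show "window l u (i + e) = window l u (j + e)" .
qed

text \<open>Closed walks in the de Bruijn graph, whose vertices are the words of length \<open>l\<close> and whose edges are
  the words of length \<open>l + 1\<close>, are represented by words \<open>u\<close> with two equal windows; \<open>S\<close> is then a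
  feedback vertex set of this graph.\<close>

definition hits_cycles :: "'a set \<Rightarrow> nat \<Rightarrow> 'a list set \<Rightarrow> bool" where
  "hits_cycles \<Sigma> l S \<longleftrightarrow> (\<forall>u \<in> lists \<Sigma>. \<forall>a b. a < b \<and> b + l \<le> length u \<and> window l u a = window l u b
     \<longrightarrow> (\<exists>t. a \<le> t \<and> t < b \<and> window l u t \<in> S))"

lemma occurrences_eq_visits:
  assumes "length s \<le> length u"
  shows "occurrences u s = card (visits (window (length s) u) (length u - length s) s)"
  unfolding occurrences_def visits_def window_def using assms
  by (intro arg_cong[where f = card]) auto

lemma take_Suc_eq_iff:
  assumes "0 < l" "length e = Suc l"
  shows "take (Suc l) w = e \<longleftrightarrow> take l w = take l e \<and> take l (tl w) = tl e"
  using assms by (cases w; cases e; cases l) (auto simp: take_Suc)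

lemma occurrences_eq_transitions:
  assumes "0 < l" "length e = Suc l" "l \<le> length u"
  shows "occurrences u e
       = card {t. t < length u - l \<and> window l u t = take l e \<and> window l u (Suc t) = tl e}"
  unfolding occurrences_def window_def using assms
  by (intro arg_cong[where f = card]) (auto simp: take_Suc_eq_iff tl_drop[symmetric] drop_Suc)

lemma singleton_counts_near_transversal:
  assumes "u \<in> lists \<Sigma>" "0 < l" "l \<le> length u" "k_abelian_class \<Sigma> (Suc l) u = {u}"
    and "hits_cycles \<Sigma> l S" "\<And>s. s \<in> S \<Longrightarrow> length s = l"
    and "length e = Suc l"
  shows "occurrences u e \<le> 2 \<or>
    (\<exists>s \<in> S. occurrences u e \<le> occurrences u s + 2 \<and> occurrences u s \<le> occurrences u e + 2)"
proof -
  have hit: "\<exists>t. a \<le> t \<and> t < b \<and> window l u t \<in> S"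
    if "a < b" "b \<le> length u - l" "window l u a = window l u b" for a b
  proof -
    have "b + l \<le> length u"
      using that(2) assms(3) by linarith
    then show ?thesis
      using assms(5)[unfolded hits_cycles_def, rule_format, OF assms(1), of a b] that by simp
  qed
  have visits: "card (visits (window l u) (length u - l) s) = occurrences u s" if "s \<in> S" for s
    using occurrences_eq_visits[of s u] assms(3,6) that by simp
  show ?thesis
    unfolding occurrences_eq_transitions[OF assms(2,7,3)]
    using transitions_near_transversal[OF windows_rigid_of_singleton_class[OF assms(1,3,4)] hit,
        of "take l e" "tl e"] visits by fastforce
qed

lemma occurrences_longer:
  "length u < length x \<Longrightarrow> occurrences u x = 0"
  unfolding occurrences_def by auto

text \<open>An occurrence of \<open>x\<close> extends to a unique factor of length \<open>l + 1\<close> unless it starts within the last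
  \<open>l\<close> letters. Hence the counts of the longest factors and the last \<open>l\<close> letters determine all other
  counts; for empty \<open>x\<close> the identity gives the total number of factors of length \<open>l + 1\<close>.\<close>

lemma occurrences_eq_sum_extensions:
  assumes "finite \<Sigma>" "u \<in> lists \<Sigma>" "l \<le> length u" "length x \<le> Suc l"
  shows "occurrences u x = (\<Sum>e | e \<in> lists \<Sigma> \<and> length e = Suc l \<and> take (length x) e = x. occurrences u e)
           + occurrences (drop (length u - l) u) x"
  using assms(2,3)
proof (induction u rule: list.induct)
  case Nil
  then show ?case by (auto intro!: sum.neutral)
next
  case (Cons a u)
  let ?E = "{e. e \<in> lists \<Sigma> \<and> length e = Suc l \<and> take (length x) e = x}"
  have finE: "finite ?E"
    by (rule finite_subset[OF _ finite_lists_length_eq[OF assms(1), of "Suc l"]]) auto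
  show ?case
  proof (cases "l = length (a # u)")
    case True
    then show ?thesis
      by (simp add: occurrences_longer)
  next
    case False
    then have l: "l \<le> length u"
      using Cons.prems by simp
    let ?w = "take (Suc l) (a # u)"
    have "(if take (length x) (a # u) = x then 1 else 0) = (if ?w \<in> ?E then 1 else (0::nat))"
    proof -
      have "take (length x) ?w = take (length x) (a # u)"
        using assms(4) by (simp add: min_def del: take_Suc_Cons)
      moreover have "set (a # u) \<subseteq> \<Sigma>"
        using Cons.prems(1) by (simp only: lists_eq_set mem_Collect_eq)
      then have "?w \<in> lists \<Sigma>"
        using set_take_subset[of "Suc l" "a # u"] unfolding lists_eq_set by blast
      moreover have "length ?w = Suc l"
        using l by simp
      ultimately show ?thesis
        by (auto simp del: take_Suc_Cons)
    qed
    also have "\<dots> = (\<Sum>e\<in>?E. if ?w = e then 1 else 0)"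
      using finE by (simp add: sum.delta')
    also have "\<dots> = (\<Sum>e\<in>?E. if take (length e) (a # u) = e then 1 else 0)"
      by (intro sum.cong) auto
    finally show ?thesis
      using Cons l by (simp add: occurrences_Cons[of a u] sum.distrib Suc_diff_le)
  qed
qed

lemma k_abelian_equiv_of_counts:
  assumes "finite \<Sigma>" "u \<in> lists \<Sigma>" "v \<in> lists \<Sigma>" "l \<le> length u" "l \<le> length v"
    and "drop (length u - l) u = drop (length v - l) v"
    and "\<And>e. e \<in> lists \<Sigma> \<Longrightarrow> length e = Suc l \<Longrightarrow> occurrences u e = occurrences v e"
  shows "k_abelian_equiv \<Sigma> (Suc l) u v"
  unfolding k_abelian_equiv_def
proof (intro ballI impI)
  fix x assume "x \<in> lists \<Sigma>" "x \<noteq> [] \<and> length x \<le> Suc l"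
  then have "length x \<le> Suc l" by simp
  then show "occurrences u x = occurrences v x"
    using occurrences_eq_sum_extensions[OF assms(1,2,4)] occurrences_eq_sum_extensions[OF assms(1,3,5)]
      assms(6,7) by (auto intro!: sum.cong)
qed

lemma sum_occurrences:
  assumes "finite \<Sigma>" "u \<in> lists \<Sigma>" "l \<le> length u"
  shows "(\<Sum>e | e \<in> lists \<Sigma> \<and> length e = Suc l. occurrences u e) = length u - l"
proof -
  have nil: "occurrences w [] = Suc (length w)" for w :: "'a list"
    by (induction w) (simp_all add: occurrences_Cons)
  show ?thesis
    using occurrences_eq_sum_extensions[OF assms, of "[]"] assms(3) by (simp add: nil)
qed

section \<open>Counting necklaces\<close>

definition rotations :: "'a list \<Rightarrow> 'a list set" where
  "rotations w = range (\<lambda>j. rotate j w)"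

lemma rotations_eq_image:
  assumes "w \<noteq> []"
  shows "rotations w = (\<lambda>j. rotate j w) ` {..<length w}"
  unfolding rotations_def
proof (intro subset_antisym subsetI)
  fix v assume "v \<in> range (\<lambda>j. rotate j w)"
  then obtain j where "v = rotate j w" by auto
  then have "v = rotate (j mod length w) w"
    using rotate_conv_mod by metis
  then show "v \<in> (\<lambda>j. rotate j w) ` {..<length w}"
    using assms by auto
qed auto

lemma rotations_eq_iff: "rotations v = rotations w \<longleftrightarrow> v \<in> rotations w"
proof
  have "v = rotate 0 v" by simp
  then have "v \<in> rotations v"
    unfolding rotations_def by blast
  then show "rotations v = rotations w \<Longrightarrow> v \<in> rotations w" by simp
next
  assume "v \<in> rotations w"
  then obtain i where v: "v = rotate i w"
    unfolding rotations_def by auto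
  have "rotate j v \<in> rotations w" for j
    unfolding v rotate_rotate rotations_def by simp
  moreover have "rotate j w \<in> rotations v" for j
  proof (cases "w = []")
    case False
    \<comment> \<open>to undo a rotation by \<open>i\<close>, go on until \<open>length w * i\<close>, a number of full turns\<close>
    let ?s = "j + (length w * i - i)"
    have "i \<le> length w * i"
      using False by (cases w) auto
    then have "?s + i = j + length w * i" by linarith
    then have "rotate ?s v = rotate (j + length w * i) w"
      unfolding v rotate_rotate by (rule arg_cong)
    also have "\<dots> = rotate j w"
      by (metis mod_mult_self2 rotate_conv_mod)
    finally show ?thesis
      unfolding rotations_def by (metis rangeI)
  qed (simp add: rotations_def v)
  ultimately show "rotations v = rotations w"
    unfolding rotations_def[of v] rotations_def[of w] using rotations_def by blast
qed

text \<open>Orbit-stabilizer in summed form: the \<open>length w\<close> rotation amounts are sorted by the word they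
  produce, and those producing \<open>v\<close> form a coset of the stabilizer of \<open>v\<close>.\<close>

lemma sum_stabilizers_rotations:
  assumes "w \<noteq> []"
  shows "(\<Sum>v\<in>rotations w. card {j. j < length w \<and> rotate j v = v}) = length w"
proof -
  let ?l = "length w"
  have "card {j. j < ?l \<and> rotate j v = v} = card {j \<in> {..<?l}. rotate j w = v}"
    if v_in: "v \<in> rotations w" for v
  proof -
    obtain i where v: "v = rotate i w"
      using v_in unfolding rotations_def by blast
    let ?f = "\<lambda>s. (s + i) mod ?l"
    have inj: "inj_on ?f {..<?l}"
    proof (intro inj_onI)
      fix s t assume st: "s \<in> {..<?l}" "t \<in> {..<?l}" "?f s = ?f t"
      then have "s mod ?l = t mod ?l"
        using cong_add_rcancel_nat[of s i t ?l] unfolding cong_def by blast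
      then show "s = t"
        using st by simp
    qed
    have bij: "?f ` {..<?l} = {..<?l}"
      by (rule endo_inj_surj[OF _ _ inj]) (use assms in auto)
    have rot: "rotate (?f s) w = rotate s v" for s
      unfolding v rotate_rotate by (metis rotate_conv_mod)
    have "{j \<in> {..<?l}. rotate j w = v} = ?f ` {j. j < ?l \<and> rotate j v = v}"
    proof (intro subset_antisym subsetI)
      fix j assume j: "j \<in> {j \<in> {..<?l}. rotate j w = v}"
      then have "j \<in> ?f ` {..<?l}"
        unfolding bij by simp
      then obtain s where "s < ?l" "j = ?f s" by auto
      then show "j \<in> ?f ` {j. j < ?l \<and> rotate j v = v}"
        using j rot[of s] by auto
    qed (use assms rot in auto)
    moreover have "inj_on ?f {j. j < ?l \<and> rotate j v = v}"
      by (rule inj_on_subset[OF inj]) auto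
    ultimately show ?thesis
      by (simp add: card_image)
  qed
  then have "(\<Sum>v\<in>rotations w. card {j. j < ?l \<and> rotate j v = v})
      = (\<Sum>v\<in>rotations w. \<Sum>j | j \<in> {..<?l} \<and> rotate j w = v. 1)"
    by simp
  also have "\<dots> = (\<Sum>j\<in>{..<?l}. 1)"
    unfolding rotations_eq_image[OF assms] by (rule sum.group) auto
  finally show ?thesis by simp
qed

text \<open>A word fixed by rotation by \<open>j\<close>, continued periodically, has periods \<open>j\<close> and \<open>length w\<close>, hence by
  Bezout their greatest common divisor.\<close>

lemma rotation_fixed_imp_periodic:
  assumes "rotate j w = w" "i < length w"
  shows "w ! i = w ! (i mod gcd j (length w))"
proof -
  let ?l = "length w" and ?g = "gcd j (length w)"
  define f where "f i = w ! (i mod ?l)" for i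
  have l: "?l > 0" using assms(2) by linarith
  have fj: "f (i + j) = f i" for i
  proof -
    have "f i = rotate j w ! (i mod ?l)"
      unfolding f_def assms(1) ..
    also have "\<dots> = f (i + j)"
      unfolding f_def using l by (subst nth_rotate) (simp_all add: mod_simps add.commute)
    finally show ?thesis by simp
  qed
  have fjn: "f (i + j * n) = f i" for i n
    by (induction n) (simp_all add: fj add.assoc[symmetric] add.commute[of j])
  have fln: "f (i + ?l * n) = f i" for i n
    unfolding f_def by simp
  obtain x y where xy: "?l * x = j * y + ?g"
    using bezout_nat[of ?l j] l by (auto simp: gcd.commute)
  have fg: "f (i + ?g) = f i" for i
    using fln[of i x] fjn[of "i + ?g" y] unfolding xy by (simp add: add_ac)
  have fgn: "f (i + ?g * n) = f i" for i n
    by (induction n) (simp_all add: fg add.assoc[symmetric] add.commute[of ?g])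
  have "f i = f (i mod ?g)"
    using fgn[of "i mod ?g" "i div ?g"] by simp
  moreover have "i mod ?g < ?l"
    using assms(2) by (rule le_less_trans[OF mod_less_eq_dividend])
  ultimately show ?thesis
    unfolding f_def using assms(2) by simp
qed

lemma card_rotation_fixed:
  assumes "finite \<Sigma>" "l > 0"
  shows "card {w \<in> lists \<Sigma>. length w = l \<and> rotate j w = w} = card \<Sigma> ^ gcd j l"
proof -
  define g where "g = gcd j l"
  let ?F = "{w \<in> lists \<Sigma>. length w = l \<and> rotate j w = w}"
  let ?V = "{v. set v \<subseteq> \<Sigma> \<and> length v = g}"
  let ?h = "\<lambda>v. map (\<lambda>i. v ! (i mod g)) [0..<l]"
  have g: "g > 0" "g \<le> l" "g dvd l" "g dvd j"
    unfolding g_def using assms(2) by (simp_all add: gcd_le2_nat)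
  have "bij_betw ?h ?V ?F"
  proof (rule bij_betw_byWitness[where f' = "take g"])
    show "\<forall>v\<in>?V. take g (?h v) = v"
      using g(1,2) by (auto intro!: nth_equalityI)
    show "\<forall>w\<in>?F. ?h (take g w) = w"
    proof
      fix w assume w: "w \<in> ?F"
      then show "?h (take g w) = w"
        using g(1,2) rotation_fixed_imp_periodic[of j w] by (auto simp: g_def[symmetric] intro!: nth_equalityI)
    qed
    show "?h ` ?V \<subseteq> ?F"
    proof
      fix w assume "w \<in> ?h ` ?V"
      then obtain v where v: "w = ?h v" "set v \<subseteq> \<Sigma>" "length v = g" by auto
      have "set w \<subseteq> \<Sigma>"
        unfolding v(1) using v(2,3) g by (force intro: nth_mem)
      moreover have "rotate j w = w"
      proof (rule nth_equalityI)
        fix i assume "i < length (rotate j w)"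
        then have i: "i < l" using v by simp
        have "rotate j w ! i = w ! ((j + i) mod l)"
          using v i by (simp add: nth_rotate)
        also have "\<dots> = v ! (((j + i) mod l) mod g)"
          using v assms(2) by simp
        also have "((j + i) mod l) mod g = i mod g"
          using g(3,4) by (metis mod_mod_cancel mod_add_left_eq dvd_imp_mod_0 add_0)
        finally show "rotate j w ! i = w ! i"
          using v i by simp
      qed simp
      ultimately show "w \<in> ?F"
        using v by auto
    qed
    show "take g ` ?F \<subseteq> ?V"
      using g by (auto dest: in_set_takeD)
  qed
  then have "card ?F = card ?V"
    by (simp add: bij_betw_same_card)
  then show ?thesis
    using card_lists_length_eq[OF assms(1)] by (simp add: g_def)
qed

lemma sum_power_gcd:
  fixes m l :: nat
  assumes "l > 0"
  shows "(\<Sum>j<l. m ^ gcd j l) = (\<Sum>d | d dvd l. totient d * m ^ (l div d))"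
proof -
  \<comment> \<open>as \<open>gcd 0 l = gcd l l\<close>, the amount 0 may be replaced by \<open>l\<close> to fit \<open>card_gcd_eq_totient\<close>\<close>
  have "{..<l} = insert 0 {0<..<l}" "{0<..l} = insert l {0<..<l}"
    using assms by auto
  then have "(\<Sum>j<l. m ^ gcd j l) = (\<Sum>j\<in>{0<..l}. m ^ gcd j l)"
    by simp
  also have "\<dots> = (\<Sum>d | d dvd l. \<Sum>j | j \<in> {0<..l} \<and> gcd j l = d. m ^ gcd j l)"
    by (rule sum.group[symmetric]) (use assms in auto)
  also have "\<dots> = (\<Sum>d | d dvd l. totient (l div d) * m ^ d)"
    using card_gcd_eq_totient[OF assms] by (intro sum.cong) auto
  also have "\<dots> = (\<Sum>d | d dvd l. totient d * m ^ (l div d))"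
    using assms by (intro sum.reindex_bij_witness[of _ "(div) l" "(div) l"]) (auto elim: dvdE)
  finally show ?thesis .
qed

text \<open>Burnside's counting: pairs of a word and a rotation fixing it are counted by orbits of words and
  by rotations.\<close>

theorem card_necklaces:
  assumes "finite \<Sigma>" "l > 0"
  shows "real (card (rotations ` {w \<in> lists \<Sigma>. length w = l})) = necklace_number (card \<Sigma>) l"
proof -
  let ?W = "{w \<in> lists \<Sigma>. length w = l}"
  let ?st = "\<lambda>w. card {j. j < l \<and> rotate j w = w}"
  have fin: "finite ?W"
    by (rule finite_subset[OF _ finite_lists_length_eq[OF assms(1), of l]]) auto
  have orbit: "{v \<in> ?W. rotations v = rotations w} = rotations w" if "w \<in> ?W" for w
    using that unfolding rotations_eq_iff by (auto simp: rotations_def)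
  have "card (rotations ` ?W) * l = (\<Sum>r\<in>rotations ` ?W. \<Sum>v | v \<in> ?W \<and> rotations v = r. ?st v)"
  proof -
    have "(\<Sum>v | v \<in> ?W \<and> rotations v = r. ?st v) = l" if r: "r \<in> rotations ` ?W" for r
    proof -
      obtain w where w: "w \<in> ?W" "r = rotations w"
        using r by blast
      then show ?thesis
        using sum_stabilizers_rotations[of w] assms(2) orbit[OF w(1)] by auto
    qed
    then show ?thesis by simp
  qed
  also have "\<dots> = (\<Sum>w\<in>?W. ?st w)"
    using fin by (intro sum.group) auto
  also have "\<dots> = (\<Sum>w\<in>?W. \<Sum>j<l. if rotate j w = w then 1 else 0)"
    by (intro sum.cong refl) (simp add: sum.If_cases Int_def)
  also have "\<dots> = (\<Sum>j<l. \<Sum>w\<in>?W. if rotate j w = w then 1 else 0)"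
    by (rule sum.swap)
  also have "\<dots> = (\<Sum>j<l. card {w \<in> lists \<Sigma>. length w = l \<and> rotate j w = w})"
    using fin by (intro sum.cong refl) (simp add: sum.If_cases Int_def conj_assoc)
  also have "\<dots> = (\<Sum>d | d dvd l. totient d * card \<Sigma> ^ (l div d))"
    using card_rotation_fixed[OF assms] sum_power_gcd[OF assms(2)] by simp
  finally have "real (card (rotations ` ?W)) * real l
      = (\<Sum>d | d dvd l. real (totient d) * real (card \<Sigma>) ^ (l div d))"
    by (simp flip: of_nat_mult of_nat_power of_nat_sum)
  then show ?thesis
    unfolding necklace_number_def using assms(2) by (simp add: field_simps)
qed

section \<open>A feedback vertex set with one word in each necklace\<close>

text \<open>Mykkeltveit's weight: the letters, read as real masses, are placed at the roots of unity of
  order \<open>length w\<close>, and the moment is the sum of mass times position.\<close>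

definition rotation_moment :: "('a \<Rightarrow> real) \<Rightarrow> 'a list \<Rightarrow> complex" where
  "rotation_moment f w = (\<Sum>i<length w. of_real (f (w ! i)) * cis (2 * pi / real (length w) * real i))"

text \<open>Following an edge of the de Bruijn graph turns the moment clockwise by one \<open>l\<close>-th of a full turn,
  after the replaced letter, which sits at position 1, has moved it horizontally. The imaginary part
  before the turn is therefore controlled.\<close>

lemma rotation_moment_shift:
  "cis (2 * pi / real (Suc (length v))) * rotation_moment f (v @ [a])
     = rotation_moment f (b # v) + of_real (f a - f b)"
proof -
  define l where "l = Suc (length v)"
  let ?th = "2 * pi / real l"
  let ?M = "\<Sum>i<length v. of_real (f (v ! i)) * cis (?th * real (Suc i))"
  have turn: "cis ?th * cis (?th * real i) = cis (?th * real (Suc i))" for i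
    by (simp add: cis_mult algebra_simps add_divide_distrib)
  have full: "cis (?th * real l) = 1"
    unfolding l_def by simp
  have "rotation_moment f (v @ [a])
      = (\<Sum>i<length v. of_real (f (v ! i)) * cis (?th * real i)) + of_real (f a) * cis (?th * real (length v))"
    unfolding rotation_moment_def l_def by (simp add: nth_append)
  then have "cis ?th * rotation_moment f (v @ [a])
      = (\<Sum>i<length v. of_real (f (v ! i)) * (cis ?th * cis (?th * real i)))
        + of_real (f a) * (cis ?th * cis (?th * real (length v)))"
    by (simp only: distrib_left sum_distrib_left mult.left_commute)
  also have "\<dots> = ?M + of_real (f a)"
    unfolding turn using full by (simp add: l_def)
  finally have "cis ?th * rotation_moment f (v @ [a]) = ?M + of_real (f a)" .
  moreover have "rotation_moment f (b # v) = of_real (f b) + ?M"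
    unfolding rotation_moment_def l_def by (simp add: sum.lessThan_Suc_shift del: sum.lessThan_Suc of_nat_Suc)
  ultimately show ?thesis
    unfolding l_def by simp
qed

lemma rotation_moment_rotate:
  "rotation_moment f (rotate j w) = cis (- (2 * pi / real (length w) * real j)) * rotation_moment f w"
proof (cases "w = []")
  case False
  let ?th = "2 * pi / real (length w)"
  show ?thesis
  proof (induction j)
    case (Suc j)
    obtain b v where v: "rotate j w = b # v"
      using False by (metis neq_Nil_conv rotate_is_Nil_conv)
    then have len: "length w = Suc (length v)"
      by (metis length_Cons length_rotate)
    have "cis ?th * rotation_moment f (rotate (Suc j) w) = rotation_moment f (rotate j w)"
      using rotation_moment_shift[of v f b b] v len by simp
    then have "cis (- ?th) * (cis ?th * rotation_moment f (rotate (Suc j) w))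
        = cis (- ?th) * (cis (- (?th * real j)) * rotation_moment f w)"
      using Suc by simp
    moreover have "cis (- ?th) * (cis ?th * x) = x" for x
      by (simp add: cis_mult flip: mult.assoc)
    moreover have "cis (- ?th) * (cis (- (?th * real j)) * x) = cis (- (?th * real (Suc j))) * x" for x
      unfolding mult.assoc[symmetric] cis_mult by (simp add: distrib_left)
    ultimately show ?case by metis
  qed simp
qed (simp add: rotation_moment_def)

lemma window_step:
  assumes "0 < l" "t + l < length u"
  obtains v where "window l u t = u ! t # v" "window l u (Suc t) = v @ [u ! (t + l)]" "Suc (length v) = l"
proof
  let ?v = "take (l - 1) (drop (Suc t) u)"
  show "window l u t = u ! t # ?v"
    unfolding window_def using assms by (cases l) (simp_all add: Cons_nth_drop_Suc[symmetric])
  show "window l u (Suc t) = ?v @ [u ! (t + l)]"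
    unfolding window_def using assms by (cases l) (simp_all add: take_Suc_conv_app_nth)
  show "Suc (length ?v) = l"
    using assms by simp
qed

text \<open>Along a closed walk every position carries the same total mass, because the letters only move from
  one position to the next; and the roots of unity sum to 0.\<close>

lemma sum_rotation_moment_closed_walk:
  assumes "3 \<le> l" "a < b" "b + l \<le> length u" "window l u a = window l u b"
  shows "(\<Sum>t=a..<b. rotation_moment f (window l u t)) = 0"
proof -
  let ?x = "cis (2 * pi / real l)"
  define K where "K i = (\<Sum>t=a..<b. f (u ! (t + i)))" for i
  have letter: "u ! (a + i) = u ! (b + i)" if "i < l" for i
    using arg_cong[OF assms(4), of "\<lambda>w. w ! i"] that assms(2,3) unfolding window_def by simp
  have const: "K i = K 0" if "i < l" for i
    using that
  proof (induction i)
    case (Suc i)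
    have "K (Suc i) - K i = (\<Sum>t=a..<b. f (u ! (Suc t + i)) - f (u ! (t + i)))"
      unfolding K_def by (simp add: sum_subtractf)
    also have "\<dots> = f (u ! (b + i)) - f (u ! (a + i))"
      using assms(2) by (intro sum_Suc_diff') simp
    finally show ?case
      using letter[of i] Suc by simp
  qed simp
  have "(\<Sum>i<l. of_real (K i) * ?x ^ i) = (\<Sum>i<l. of_real (K 0) * ?x ^ i)"
    by (rule sum.cong[OF refl], subst const) auto
  also have "\<dots> = of_real (K 0) * (\<Sum>i<l. ?x ^ i)"
    by (simp add: sum_distrib_left)
  also have "(\<Sum>i<l. ?x ^ i) = 0"
  proof -
    have "0 < 2 * pi / real l" "2 * pi / real l < pi"
      using assms(1) by (simp_all add: field_simps)
    then have "sin (2 * pi / real l) > 0"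
      by (intro sin_gt_zero) auto
    then have "?x \<noteq> 1"
      by (auto simp: complex_eq_iff)
    moreover have "?x ^ l = 1"
      using assms(1) by (simp add: DeMoivre)
    ultimately show ?thesis
      by (simp add: geometric_sum)
  qed
  finally have zero: "(\<Sum>i<l. of_real (K i) * ?x ^ i) = 0" by simp
  have "(\<Sum>t=a..<b. rotation_moment f (window l u t))
      = (\<Sum>t=a..<b. \<Sum>i<l. of_real (f (u ! (t + i))) * ?x ^ i)"
  proof (rule sum.cong[OF refl])
    fix t assume "t \<in> {a..<b}"
    then have "length (window l u t) = l" "\<And>i. i < l \<Longrightarrow> window l u t ! i = u ! (t + i)"
      unfolding window_def using assms(3) by auto
    then show "rotation_moment f (window l u t) = (\<Sum>i<l. of_real (f (u ! (t + i))) * ?x ^ i)"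
      unfolding rotation_moment_def by (simp add: DeMoivre mult.commute)
  qed
  also have "\<dots> = (\<Sum>i<l. \<Sum>t=a..<b. of_real (f (u ! (t + i))) * ?x ^ i)"
    by (rule sum.swap)
  also have "\<dots> = (\<Sum>i<l. of_real (K i) * ?x ^ i)"
    unfolding K_def by (simp add: sum_distrib_right)
  finally show ?thesis
    using zero by simp
qed

lemma crossing_sector:
  assumes "0 < th" "th < pi" "Im z < 0" "0 \<le> Im (cis th * z)"
  obtains al where "z = rcis (cmod z) al" "- th \<le> al" "al < 0"
proof
  define al where "al = Arg z"
  have z: "z = rcis (cmod z) al"
    unfolding al_def by (rule rcis_cmod_Arg[symmetric])
  have al: "- pi < al" "al \<le> pi"
    unfolding al_def using Arg_bounded by auto
  have "z \<noteq> 0" using assms(3) by auto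
  have "Im z = cmod z * sin al"
    by (subst z) (simp add: rcis_def)
  then have "sin al < 0"
    using assms(3) \<open>z \<noteq> 0\<close> by (simp add: mult_less_0_iff)
  then show "al < 0"
    using sin_ge_zero[of al] al by linarith
  have "cis th * z = rcis (cmod z) (th + al)"
    by (subst z) (simp add: rcis_def cis_mult[symmetric])
  then have "Im (cis th * z) = cmod z * sin (th + al)"
    by simp
  then have "0 \<le> sin (th + al)"
    using assms(4) \<open>z \<noteq> 0\<close> by (simp add: zero_le_mult_iff)
  moreover have "sin (th + al) < 0" if "th + al < 0"
  proof -
    have "0 < sin (- (th + al))"
      by (rule sin_gt_zero) (use that al assms(1) in linarith)+
    then show ?thesis
      unfolding sin_minus by simp
  qed
  ultimately show "- th \<le> al" by force
qed (rule rcis_cmod_Arg[symmetric])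

text \<open>The moments that have just crossed the positive real axis clockwise form a half-open sector of angle
  \<open>2 * pi / l\<close>. Rotating a word turns its moment by multiples of that angle, so at most one rotation
  lands in the sector.\<close>

lemma crossing_rotation_unique:
  assumes "3 \<le> l" "Im z < 0" "0 \<le> Im (cis (2 * pi / real l) * z)"
    and "z' = cis (- (2 * pi / real l * real j)) * z"
    and "Im z' < 0" "0 \<le> Im (cis (2 * pi / real l) * z')"
  shows "l dvd j"
proof -
  define th where "th = 2 * pi / real l"
  have th: "0 < th" "th < pi" "th * real l = 2 * pi"
    unfolding th_def using assms(1) by (simp_all add: field_simps)
  obtain al where al: "z = rcis (cmod z) al" "- th \<le> al" "al < 0"
    using crossing_sector[OF th(1,2) assms(2)] assms(3) unfolding th_def by blast
  obtain al' where al': "z' = rcis (cmod z') al'" "- th \<le> al'" "al' < 0"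
    using crossing_sector[OF th(1,2) assms(5)] assms(6) unfolding th_def by blast
  have "cmod z' = cmod z" "z \<noteq> 0"
    unfolding assms(4) using assms(2) by (auto simp: norm_mult)
  have "z' = rcis (cmod z) (al - th * real j)"
    unfolding assms(4) th_def[symmetric] by (subst al(1)) (simp add: cis_rcis_eq rcis_mult)
  then have "cis al' = cis (al - th * real j)"
    using al'(1) \<open>z \<noteq> 0\<close> \<open>cmod z' = cmod z\<close> by (simp add: rcis_def)
  then obtain n :: int where n: "al' = al - th * real j + 2 * pi * of_int n"
    using sin_cos_eq_iff[of al' "al - th * real j"] by (auto simp: complex_eq_iff)
  also have "\<dots> = al + th * of_int (int l * n - int j)"
    using th(3) by (simp add: algebra_simps)
  finally have "\<bar>th * of_int (int l * n - int j)\<bar> < th * 1"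
    using al(2,3) al'(2,3) by linarith
  then have "\<bar>int l * n - int j\<bar> < 1"
    using th(1) by (simp add: abs_mult del: of_int_diff)
  then have "int j = int l * n" by linarith
  then have "int l dvd int j" by simp
  then show ?thesis by simp
qed

text \<open>If a closed walk never crosses the positive real axis downwards, then once its moment lies in the
  closed upper half plane it stays there. As the moments sum to 0, their imaginary parts can be neither
  all negative nor nonnegative with a positive one, so they all vanish. Turned back by
  \<open>2 * pi / l\<close>, an angle strictly between 0 and \<open>pi\<close> as \<open>l \<ge> 3\<close>, each of these real moments is
  still real, so it is 0; and then no step moves it horizontally, so the incoming and the outgoing
  letter have the same weight.\<close>

lemma closed_walk_pure_rotation:
  assumes l: "3 \<le> l" and walk: "a < b" "b + l \<le> length u" "window l u a = window l u b"
    and avoid: "\<And>t. a \<le> t \<Longrightarrow> t < b \<Longrightarrow> Im (rotation_moment f (window l u t)) < 0 \<Longrightarrow>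
      \<not> 0 \<le> Im (cis (2 * pi / real l) * rotation_moment f (window l u t))"
    and t: "a \<le> t" "t < b"
  shows "rotation_moment f (window l u t) = 0 \<and> f (u ! (t + l)) = f (u ! t)"
proof -
  define th where "th = 2 * pi / real l"
  define z where "z t = rotation_moment f (window l u t)" for t
  have zab: "z b = z a"
    unfolding z_def walk(3) ..
  have step: "cis th * z (Suc t) = z t + of_real (f (u ! (t + l)) - f (u ! t))" if tb: "t < b" for t
  proof -
    obtain v where "window l u t = u ! t # v" "window l u (Suc t) = v @ [u ! (t + l)]" "Suc (length v) = l"
      by (rule window_step[of l t u]) (use l walk tb in auto)
    then show ?thesis
      unfolding z_def th_def using rotation_moment_shift[of v f] by metis
  qed
  then have Im_step: "Im (cis th * z (Suc t)) = Im (z t)" if "t < b" for t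
    using that by simp
  have avoid': "\<not> (Im (z t) < 0 \<and> 0 \<le> Im (cis th * z t))" if "a \<le> t" "t \<le> b" for t
    using avoid[of t] avoid[of a] that walk(1) zab unfolding z_def th_def by (cases "t = b") auto
  have up: "Im (z s) \<ge> 0" if "a \<le> t" "t \<le> s" "s \<le> b" "Im (z t) \<ge> 0" for s t
    using that(2,3)
  proof (induction s rule: dec_induct)
    case (step n)
    then have "0 \<le> Im (cis th * z (Suc n))"
      using Im_step[of n] by simp
    then show ?case
      using avoid'[of "Suc n"] that(1) step by auto
  qed (use that in simp)
  have sum0: "(\<Sum>t=a..<b. Im (z t)) = 0"
    using sum_rotation_moment_closed_walk[OF l walk, of f] by (simp add: z_def flip: Im_sum)
  have "\<exists>t\<in>{a..<b}. Im (z t) \<ge> 0"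
  proof (rule ccontr)
    assume "\<not> ?thesis"
    then have "(\<Sum>t=a..<b. Im (z t)) < (\<Sum>t=a..<b. 0)"
      using walk(1) by (intro sum_strict_mono) (auto simp: not_le)
    then show False
      using sum0 by simp
  qed
  then obtain t0 where t0: "a \<le> t0" "t0 < b" "Im (z t0) \<ge> 0" by auto
  then have "Im (z a) \<ge> 0"
    using up[of t0 b] zab by simp
  then have "Im (z t) \<ge> 0" if "a \<le> t" "t \<le> b" for t
    using up[of a t] that by simp
  then have "\<forall>t\<in>{a..<b}. Im (z t) = 0"
    using sum0 by (subst (asm) sum_nonneg_eq_0_iff) auto
  then have Im0: "Im (z t) = 0" if "a \<le> t" "t \<le> b" for t
    using that zab walk(1) by (cases "t = b") auto
  have "0 < th" "th < pi"
    unfolding th_def using l by (simp_all add: field_simps)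
  then have "sin th > 0"
    by (intro sin_gt_zero)
  have zero_Suc: "z (Suc t) = 0" if "a \<le> t" "t < b" for t
  proof -
    have "sin th * Re (z (Suc t)) = 0"
      using Im_step[of t] Im0[of t] Im0[of "Suc t"] that by simp
    then show ?thesis
      using \<open>sin th > 0\<close> Im0[of "Suc t"] that by (simp add: complex_eq_iff)
  qed
  have zero: "z t = 0" if "a \<le> t" "t \<le> b" for t
  proof (cases "t = a")
    case True
    then show ?thesis
      using zero_Suc[of "b - 1"] walk(1) zab by simp
  next
    case False
    then show ?thesis
      using zero_Suc[of "t - 1"] that by simp
  qed
  have "complex_of_real (f (u ! (t + l)) - f (u ! t)) = 0"
    using step[of t] zero[of t] zero[of "Suc t"] t by simp
  then show ?thesis
    using zero[of t] t unfolding z_def by (simp flip: of_real_diff)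
qed

text \<open>The transversal consists of the words whose moment has just crossed the positive real axis, and
  of one representative of every necklace of moment 0. A closed walk that avoids the former
  runs through a complete necklace of moment 0 and so meets the latter.\<close>

lemma necklace_transversal_ge_3:
  assumes "finite \<Sigma>" "3 \<le> l"
  shows "\<exists>S \<subseteq> {w \<in> lists \<Sigma>. length w = l}. inj_on rotations S \<and> hits_cycles \<Sigma> l S"
proof -
  obtain lab :: "'a \<Rightarrow> nat" where lab: "inj_on lab \<Sigma>"
    using finite_imp_inj_to_nat_seg[OF assms(1)] by blast
  define f where "f x = real (lab x)" for x
  have f_inj: "x = y" if "x \<in> \<Sigma>" "y \<in> \<Sigma>" "f x = f y" for x y
    using that lab unfolding f_def by (auto dest: inj_onD)
  define rep :: "'a list set \<Rightarrow> 'a list" where "rep R = (SOME w. w \<in> R)" for R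
  define th where "th = 2 * pi / real l"
  let ?W = "{w \<in> lists \<Sigma>. length w = l}"
  let ?P = "rotation_moment f"
  define T where "T = {w \<in> ?W. Im (?P w) < 0 \<and> 0 \<le> Im (cis th * ?P w)}"
  define Z where "Z = {w \<in> ?W. ?P w = 0 \<and> w = rep (rotations w)}"
  have rotate_W: "length w = l \<Longrightarrow> ?P (rotate j w) = cis (- (th * real j)) * ?P w" for j w
    using rotation_moment_rotate[of f j w] unfolding th_def by simp
  have "inj_on rotations (T \<union> Z)"
  proof (rule inj_onI)
    fix v w assume vw: "v \<in> T \<union> Z" "w \<in> T \<union> Z" "rotations v = rotations w"
    then obtain j where j: "v = rotate j w"
      unfolding rotations_eq_iff by (auto simp: rotations_def)
    have w: "length w = l"
      using vw unfolding T_def Z_def by auto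
    have v: "?P v = cis (- (th * real j)) * ?P w"
      unfolding j by (rule rotate_W[OF w])
    consider "v \<in> T" "w \<in> T" | "?P w = 0" "w \<in> Z" | "?P v = 0" "v \<in> Z"
      using vw unfolding Z_def by auto
    then show "v = w"
    proof cases
      case 1
      then have "l dvd j"
        using crossing_rotation_unique[OF assms(2), of "?P w" "?P v" j] v
        unfolding T_def th_def by simp
      then show ?thesis
        unfolding j using w by simp
    next
      case 2
      then have "v \<in> Z"
        using v vw(1) unfolding T_def by auto
      then show ?thesis
        using 2 vw(3) unfolding Z_def by simp
    next
      case 3
      then have "w \<in> Z"
        using v vw(2) unfolding T_def by auto
      then show ?thesis
        using 3 vw(3) unfolding Z_def by simp
    qed
  qed
  moreover have "hits_cycles \<Sigma> l (T \<union> Z)"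
    unfolding hits_cycles_def
  proof (intro ballI allI impI, elim conjE, rule ccontr)
    fix u a b
    assume u: "u \<in> lists \<Sigma>" and walk: "a < b" "b + l \<le> length u" "window l u a = window l u b"
      and no: "\<not> (\<exists>t\<ge>a. t < b \<and> window l u t \<in> T \<union> Z)"
    have in_W: "window l u t \<in> ?W" if "t \<le> b" for t
      using that u walk(2) unfolding window_def
      by (auto dest: in_set_takeD in_set_dropD)
    have pure: "?P (window l u t) = 0 \<and> f (u ! (t + l)) = f (u ! t)" if "a \<le> t" "t < b" for t
    proof (rule closed_walk_pure_rotation[OF assms(2) walk _ that])
      fix s assume "a \<le> s" "s < b" "Im (?P (window l u s)) < 0"
      then show "\<not> 0 \<le> Im (cis (2 * pi / real l) * ?P (window l u s))"
        using no in_W[of s] unfolding T_def th_def by auto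
    qed
    have step: "window l u (Suc t) = rotate1 (window l u t)" if tab: "a \<le> t" "t < b" for t
    proof -
      obtain v where v: "window l u t = u ! t # v" "window l u (Suc t) = v @ [u ! (t + l)]"
        by (rule window_step[of l t u]) (use assms(2) walk tab in auto)
      have "u ! (t + l) \<in> \<Sigma>" "u ! t \<in> \<Sigma>"
        using u tab walk(2) by (auto simp: in_lists_conv_set)
      then have "u ! (t + l) = u ! t"
        using f_inj pure[OF tab] by blast
      then show ?thesis
        unfolding v by simp
    qed
    define w where "w = window l u a"
    have rot: "window l u (a + j) = rotate j w" if "j \<le> b - a" for j
      using that
    proof (induction j)
      case (Suc j)
      then show ?case
        using step[of "a + j"] by simp
    qed (simp add: w_def)
    have "w \<in> rotations w"
      using rotations_eq_iff by blast
    then have "rep (rotations w) \<in> rotations w"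
      unfolding rep_def by (rule someI)
    then obtain j where j: "rep (rotations w) = rotate j w"
      unfolding rotations_def by blast
    let ?c = "b - a"
    have period: "rotate ?c w = w"
      using rot[of ?c] walk unfolding w_def by simp
    have periods: "rotate (?c * n) w = w" for n
      by (induction n) (simp_all add: rotate_rotate[symmetric] period)
    have "rotate j w = rotate (j mod ?c) (rotate (?c * (j div ?c)) w)"
      unfolding rotate_rotate by simp
    also have "\<dots> = window l u (a + j mod ?c)"
      using rot[of "j mod ?c"] walk(1) unfolding periods by (simp add: less_imp_le)
    finally have rep: "rep (rotations w) = window l u (a + j mod ?c)"
      using j by simp
    have lt: "a + j mod ?c < b"
      using walk(1) mod_less_divisor[of ?c j] by linarith
    have "rotations (window l u (a + j mod ?c)) = rotations w"
      unfolding rotations_eq_iff rep[symmetric] by fact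
    then have "window l u (a + j mod ?c) \<in> Z"
      unfolding Z_def using in_W[of "a + j mod ?c"] pure[of "a + j mod ?c"] lt rep by simp
    then show False
      using no lt by auto
  qed
  moreover have "T \<union> Z \<subseteq> ?W"
    unfolding T_def Z_def by auto
  ultimately show ?thesis by blast
qed

text \<open>For \<open>l = 2\<close> all moments are real and the geometric argument says nothing, but a closed walk cannot
  decrease at every step in a linear order of the letters.\<close>

lemma necklace_transversal_2:
  assumes "finite \<Sigma>"
  shows "\<exists>S \<subseteq> {w \<in> lists \<Sigma>. length w = 2}. inj_on rotations S \<and> hits_cycles \<Sigma> 2 S"
proof -
  obtain lab :: "'a \<Rightarrow> nat" where lab: "inj_on lab \<Sigma>"
    using finite_imp_inj_to_nat_seg[OF assms] by blast
  define S where "S = {w \<in> lists \<Sigma>. length w = 2 \<and> lab (w ! 0) \<le> lab (w ! 1)}"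
  have "inj_on rotations S"
  proof (rule inj_onI)
    fix v w assume vw: "v \<in> S" "w \<in> S" "rotations v = rotations w"
    then obtain x y where w: "w = [x, y]" "x \<in> \<Sigma>" "y \<in> \<Sigma>" "lab x \<le> lab y"
      unfolding S_def by (auto simp: length_Suc_conv numeral_2_eq_2)
    have "v \<in> (\<lambda>j. rotate j w) ` {..<Suc (Suc 0)}"
      using vw(3) w(1) rotations_eq_image[of w] unfolding rotations_eq_iff by simp
    then have "v = w \<or> v = [y, x]"
      using w(1) by (auto simp: lessThan_Suc)
    moreover have "x = y" if "v = [y, x]"
      using vw(1) w lab that unfolding S_def by (auto dest: inj_onD)
    ultimately show "v = w"
      using w(1) by auto
  qed
  moreover have "hits_cycles \<Sigma> 2 S"
    unfolding hits_cycles_def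
  proof (intro ballI allI impI, elim conjE, rule ccontr)
    fix u a b
    assume u: "u \<in> lists \<Sigma>" and walk: "a < b" "b + 2 \<le> length u" "window 2 u a = window 2 u b"
      and no: "\<not> (\<exists>t\<ge>a. t < b \<and> window 2 u t \<in> S)"
    have win: "window 2 u t = [u ! t, u ! Suc t]" if "t + 2 \<le> length u" for t
      using that unfolding window_def
      by (simp add: numeral_2_eq_2 Cons_nth_drop_Suc[symmetric])
    have desc: "lab (u ! Suc t) < lab (u ! t)" if "a \<le> t" "t < b" for t
    proof (rule ccontr)
      assume "\<not> ?thesis"
      moreover have "u ! t \<in> \<Sigma>" "u ! Suc t \<in> \<Sigma>"
        using u that walk(2) by (auto simp: in_lists_conv_set)
      ultimately have "window 2 u t \<in> S"
        unfolding S_def using win[of t] that walk(2) by simp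
      then show False
        using no that by blast
    qed
    have "lab (u ! t) < lab (u ! a)" if "Suc a \<le> t" "t \<le> b" for t
      using that
    proof (induction t rule: dec_induct)
      case (step n)
      then show ?case
        using desc[of n] by simp
    qed (use desc[of a] walk in simp)
    then have "lab (u ! b) < lab (u ! a)"
      using walk(1) by simp
    moreover have "u ! a = u ! b"
      using win[of a] win[of b] walk by simp
    ultimately show False by simp
  qed
  moreover have "S \<subseteq> {w \<in> lists \<Sigma>. length w = 2}"
    unfolding S_def by auto
  ultimately show ?thesis by blast
qed

lemma necklace_transversal_1:
  "\<exists>S \<subseteq> {w \<in> lists \<Sigma>. length w = 1}. inj_on rotations S \<and> hits_cycles \<Sigma> 1 S"
proof (intro exI conjI)
  let ?S = "{w \<in> lists \<Sigma>. length w = 1}"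
  show "inj_on rotations ?S"
  proof (rule inj_onI)
    fix v w assume "v \<in> ?S" "w \<in> ?S" "rotations v = rotations w"
    then show "v = w"
      unfolding rotations_eq_iff by (auto simp: rotations_def)
  qed
  show "hits_cycles \<Sigma> 1 ?S"
    unfolding hits_cycles_def
  proof (intro ballI allI impI)
    fix u a b assume "u \<in> lists \<Sigma>" "a < b \<and> b + 1 \<le> length u \<and> window 1 u a = window 1 u b"
    then have "window 1 u a \<in> ?S"
      unfolding window_def by (auto dest: in_set_takeD in_set_dropD)
    then show "\<exists>t\<ge>a. t < b \<and> window 1 u t \<in> ?S"
      using \<open>a < b \<and> _\<close> by blast
  qed
qed simp

text \<open>Mykkeltveit's theorem. For \<open>l \<le> 2\<close> the moments lie on the real axis, where crossing it has no
  meaning, and elementary choices take their place.\<close>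

theorem necklace_transversal:
  assumes "finite \<Sigma>" "0 < l"
  obtains S where "S \<subseteq> {w \<in> lists \<Sigma>. length w = l}" "inj_on rotations S" "hits_cycles \<Sigma> l S"
proof -
  consider "l = 1" | "l = 2" | "3 \<le> l"
    using assms(2) by linarith
  then have "\<exists>S \<subseteq> {w \<in> lists \<Sigma>. length w = l}. inj_on rotations S \<and> hits_cycles \<Sigma> l S"
    using necklace_transversal_1 necklace_transversal_2[OF assms(1)]
      necklace_transversal_ge_3[OF assms(1)] by cases auto
  then show thesis
    using that by blast
qed

section \<open>Counting singleton classes\<close>

definition singleton_words :: "'a set \<Rightarrow> nat \<Rightarrow> nat \<Rightarrow> 'a list set" where
  "singleton_words \<Sigma> k n = {u \<in> lists \<Sigma>. length u = n \<and> k_abelian_class \<Sigma> k u = {u}}"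

lemma finite_words [simp]:
  assumes "finite \<Sigma>"
  shows "finite {u \<in> lists \<Sigma>. length u = n}"
  by (rule finite_subset[OF _ finite_lists_length_eq[OF assms, of n]]) auto

lemma card_singleton_classes_le:
  assumes "finite \<Sigma>"
  shows "card (singleton_classes \<Sigma> k n) \<le> card (singleton_words \<Sigma> k n)"
proof -
  have "singleton_classes \<Sigma> k n \<subseteq> (\<lambda>u. {u}) ` singleton_words \<Sigma> k n"
  proof
    fix C assume "C \<in> singleton_classes \<Sigma> k n"
    then obtain u where u: "C = k_abelian_class \<Sigma> k u" "u \<in> lists \<Sigma>" "length u = n" "card C = 1"
      unfolding singleton_classes_def k_abelian_classes_def by auto
    then have "u \<in> C"
      unfolding k_abelian_class_def k_abelian_equiv_def by simp
    moreover obtain w where "C = {w}"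
      using u(4) by (auto simp: card_1_singleton_iff)
    ultimately have "C = {u}" by simp
    then show "C \<in> (\<lambda>u. {u}) ` singleton_words \<Sigma> k n"
      using u unfolding singleton_words_def by auto
  qed
  moreover have fin: "finite (singleton_words \<Sigma> k n)"
    unfolding singleton_words_def by (rule finite_subset[OF _ finite_words[OF assms, of n]]) auto
  ultimately have "card (singleton_classes \<Sigma> k n) \<le> card ((\<lambda>u. {u}) ` singleton_words \<Sigma> k n)"
    by (intro card_mono) auto
  also have "\<dots> \<le> card (singleton_words \<Sigma> k n)"
    by (rule card_image_le[OF fin])
  finally show ?thesis .
qed

lemma occurrences_le_length:
  assumes "x \<noteq> []"
  shows "occurrences u x \<le> length u"
proof -
  have "{i. i + length x \<le> length u \<and> take (length x) (drop i u) = x} \<subseteq> {..<length u}"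
    using assms by (cases x) auto
  then have "occurrences u x \<le> card {..<length u}"
    unfolding occurrences_def by (intro card_mono) auto
  then show ?thesis by simp
qed

text \<open>The multiplicity of a long factor, shifted by 2, as a bounded number plus possibly the
  multiplicity of a word of the transversal. The shift keeps the bounded number natural although a
  factor can occur up to two times less often than the word it is compared with.\<close>

definition decode :: "'a list option \<times> nat \<Rightarrow> 'a list \<Rightarrow> nat" where
  "decode c u = snd c + (case fst c of None \<Rightarrow> 0 | Some s \<Rightarrow> occurrences u s)"

lemma singleton_word_decode:
  assumes "0 < l" "l \<le> n" "u \<in> singleton_words \<Sigma> (Suc l) n"
    and "hits_cycles \<Sigma> l S" "\<And>s. s \<in> S \<Longrightarrow> length s = l" "length e = Suc l"
  shows "\<exists>c \<in> insert None (Some ` S) \<times> {..4}. occurrences u e + 2 = decode c u"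
proof -
  from assms(3) have u: "u \<in> lists \<Sigma>" "length u = n" "k_abelian_class \<Sigma> (Suc l) u = {u}"
    unfolding singleton_words_def by auto
  consider "occurrences u e \<le> 2" | s where "s \<in> S" "occurrences u e \<le> occurrences u s + 2"
      "occurrences u s \<le> occurrences u e + 2"
    using singleton_counts_near_transversal[OF u(1) assms(1) _ u(3) assms(4,5,6)] u(2) assms(2) by auto
  then show ?thesis
  proof cases
    case 1
    then show ?thesis
      by (intro bexI[of _ "(None, occurrences u e + 2)"]) (auto simp: decode_def)
  next
    case 2
    then show ?thesis
      by (intro bexI[of _ "(Some s, occurrences u e + 2 - occurrences u s)"]) (auto simp: decode_def)
  qed
qed

text \<open>The multiplicity of one transversal word \<open>s0\<close> can be left out, because the total is known: if some
  count is compared with \<open>s0\<close>, a larger multiplicity of \<open>s0\<close> increases the total strictly, and otherwise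
  \<open>s0\<close> does not enter any count. This accounts for the \<open>- 1\<close> in the exponent.\<close>

lemma decode_determines_counts:
  assumes "finite E" "(\<Sum>e\<in>E. occurrences u e) = (\<Sum>e\<in>E. occurrences v e)"
    and u: "\<And>e. e \<in> E \<Longrightarrow> occurrences u e + 2 = decode (c e) u"
    and v: "\<And>e. e \<in> E \<Longrightarrow> occurrences v e + 2 = decode (c e) v"
    and c: "\<And>e s. e \<in> E \<Longrightarrow> fst (c e) = Some s \<Longrightarrow> s \<in> S"
    and eq: "\<And>s. s \<in> S - {s0} \<Longrightarrow> occurrences u s = occurrences v s"
    and e: "e \<in> E"
  shows "occurrences u e = occurrences v e"
proof -
  have not_less: "\<not> occurrences p s0 < occurrences q s0"
    if e: "e \<in> E" "fst (c e) = Some s0"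
      and sum: "(\<Sum>e\<in>E. occurrences p e) = (\<Sum>e\<in>E. occurrences q e)"
      and p: "\<And>e. e \<in> E \<Longrightarrow> occurrences p e + 2 = decode (c e) p"
      and q: "\<And>e. e \<in> E \<Longrightarrow> occurrences q e + 2 = decode (c e) q"
      and eq: "\<And>s. s \<in> S - {s0} \<Longrightarrow> occurrences p s = occurrences q s" for p q e
  proof
    assume less: "occurrences p s0 < occurrences q s0"
    have "decode (c e) p \<le> decode (c e) q" if "e \<in> E" for e
      using c[OF that] eq less by (fastforce simp: decode_def split: option.split)
    then have "occurrences p e \<le> occurrences q e" if "e \<in> E" for e
      using p[OF that] q[OF that] that by (metis add_le_cancel_right)
    moreover have "decode (c e) p < decode (c e) q"
      using e less by (simp add: decode_def)
    then have "occurrences p e < occurrences q e"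
      using p[OF e(1)] q[OF e(1)] by linarith
    ultimately have "(\<Sum>e\<in>E. occurrences p e) < (\<Sum>e\<in>E. occurrences q e)"
      using assms(1) e(1) by (intro sum_strict_mono_ex1) auto
    then show False
      using sum by simp
  qed
  have "decode (c e) u = decode (c e) v"
  proof (cases "fst (c e)")
    case None
    then show ?thesis by (simp add: decode_def)
  next
    case (Some s)
    have "occurrences u s = occurrences v s"
    proof (cases "s = s0")
      case True
      have "\<not> occurrences u s0 < occurrences v s0"
        by (rule not_less[of e]) (use e Some True assms(2) u v eq in auto)
      moreover have "\<not> occurrences v s0 < occurrences u s0"
        by (rule not_less[of e]) (use e Some True assms(2) u v eq in auto)
      ultimately show ?thesis
        using True by simp
    next
      case False
      then show ?thesis
        using eq c[OF e Some] by simp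
    qed
    then show ?thesis
      using Some by (simp add: decode_def)
  qed
  then show ?thesis
    using u[OF e] v[OF e] by simp
qed

text \<open>A singleton word is determined by its last \<open>l\<close> letters, by the code of each long factor, and by the
  multiplicities of the transversal words other than \<open>s0\<close>. The number of choices for the first two
  does not depend on \<open>n\<close>.\<close>

lemma card_singleton_words_le:
  assumes fin: "finite \<Sigma>" and l: "0 < l"
    and S: "hits_cycles \<Sigma> l S" "S \<subseteq> {w \<in> lists \<Sigma>. length w = l}" "s0 \<in> S"
  obtains K :: nat where "\<And>n. l \<le> n \<Longrightarrow> card (singleton_words \<Sigma> (Suc l) n) \<le> K * (n + 1) ^ (card S - 1)"
proof
  let ?V = "{w \<in> lists \<Sigma>. length w = l}"
  let ?E = "{e \<in> lists \<Sigma>. length e = Suc l}"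
  let ?C = "?E \<rightarrow>\<^sub>E insert None (Some ` S) \<times> {..4::nat}"
  have finS: "finite S"
    by (rule finite_subset[OF S(2) finite_words[OF fin]])
  have lenS: "length s = l" if "s \<in> S" for s
    using S(2) that by auto
  fix n assume n: "l \<le> n"
  let ?W = "singleton_words \<Sigma> (Suc l) n"
  let ?B = "?V \<times> ?C \<times> (S - {s0} \<rightarrow>\<^sub>E {..n})"
  define code where "code u b \<longleftrightarrow> fst b = drop (length u - l) u \<and>
      (\<forall>e\<in>?E. occurrences u e + 2 = decode (fst (snd b) e) u) \<and>
      (\<forall>s\<in>S - {s0}. snd (snd b) s = occurrences u s)" for u b
  have ex: "\<exists>b\<in>?B. code u b" if u: "u \<in> ?W" for u
  proof -
    have uW: "u \<in> lists \<Sigma>" "length u = n"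
      using u unfolding singleton_words_def by auto
    have "\<forall>e\<in>?E. \<exists>c. c \<in> insert None (Some ` S) \<times> {..4} \<and> occurrences u e + 2 = decode c u"
      using singleton_word_decode[OF l n u S(1) lenS] by blast
    from bchoice[OF this] obtain c where c: "\<forall>e\<in>?E. c e \<in> insert None (Some ` S) \<times> {..4} \<and> occurrences u e + 2 = decode (c e) u"
      ..
    have "drop (length u - l) u \<in> ?V"
      using uW n by (auto dest: in_set_dropD)
    moreover have "restrict c ?E \<in> ?C"
      using c by (simp only: restrict_PiE_iff) blast
    moreover have "restrict (occurrences u) (S - {s0}) \<in> S - {s0} \<rightarrow>\<^sub>E {..n}"
      unfolding restrict_PiE_iff
    proof
      fix s assume "s \<in> S - {s0}"
      then have "s \<noteq> []"
        using lenS[of s] l by auto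
      then show "occurrences u s \<in> {..n}"
        using occurrences_le_length[of s u] uW by simp
    qed
    ultimately have "(drop (length u - l) u, restrict c ?E, restrict (occurrences u) (S - {s0})) \<in> ?B"
      by blast
    moreover have "code u (drop (length u - l) u, restrict c ?E, restrict (occurrences u) (S - {s0}))"
      unfolding code_def using c by simp
    ultimately show ?thesis by blast
  qed
  have "\<forall>u\<in>?W. \<exists>b. b \<in> ?B \<and> code u b"
    using ex unfolding Bex_def by (rule ballI)
  from bchoice[OF this] obtain g where g: "\<forall>u\<in>?W. g u \<in> ?B \<and> code u (g u)" ..
  have "inj_on g ?W"
  proof (rule inj_onI)
    fix u v assume uv: "u \<in> ?W" "v \<in> ?W" "g u = g v"
    obtain suf c q where b: "g u = (suf, c, q)" by (cases "g u")
    have "code v (g v)" "code u (g u)" "g u \<in> ?B"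
      using g uv(1,2) by (auto simp only:)
    then have codes: "code u (suf, c, q)" "code v (suf, c, q)" and cC: "c \<in> ?C"
      unfolding uv(3)[symmetric] b mem_Sigma_iff by (simp_all only:)
    have W: "u \<in> lists \<Sigma>" "length u = n" "v \<in> lists \<Sigma>" "length v = n" "k_abelian_class \<Sigma> (Suc l) v = {v}"
      using uv unfolding singleton_words_def by auto
    have "occurrences u e = occurrences v e" if "e \<in> ?E" for e
    proof (rule decode_determines_counts[where E = ?E and c = c and S = S and ?s0.0 = s0])
      show "(\<Sum>e\<in>?E. occurrences u e) = (\<Sum>e\<in>?E. occurrences v e)"
        using sum_occurrences[OF fin] W n by simp
      show "\<And>e s. e \<in> ?E \<Longrightarrow> fst (c e) = Some s \<Longrightarrow> s \<in> S"
        using cC by (fastforce dest: PiE_mem)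
    qed (use codes that fin in \<open>auto simp: code_def\<close>)
    moreover have "drop (length u - l) u = drop (length v - l) v"
      using codes unfolding code_def by simp
    ultimately have "k_abelian_equiv \<Sigma> (Suc l) u v"
      using k_abelian_equiv_of_counts[OF fin W(1,3)] W n by simp
    then have "u \<in> k_abelian_class \<Sigma> (Suc l) v"
      unfolding k_abelian_class_def using W by simp
    then show "u = v"
      using W(5) by simp
  qed
  moreover have "g ` ?W \<subseteq> ?B"
    by (rule image_subsetI) (rule g[THEN bspec, THEN conjunct1])
  moreover have "finite ?B"
    using fin finS by (intro finite_cartesian_product finite_PiE finite_words) auto
  ultimately have "card ?W \<le> card ?B"
    by (rule card_inj_on_le)
  also have "\<dots> = card ?V * card ?C * (n + 1) ^ (card S - 1)"
    using finS S(3) by (simp add: card_cartesian_product card_funcsetE)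
  finally show "card ?W \<le> card ?V * card ?C * (n + 1) ^ (card S - 1)" .
qed

text \<open>The loop at a constant word is a closed walk.\<close>

lemma hits_cycles_nonempty:
  assumes "hits_cycles \<Sigma> l S" "a \<in> \<Sigma>"
  shows "S \<noteq> {}"
proof -
  let ?u = "replicate (Suc l) a"
  have "take l ?u = replicate l a"
    by (simp only: take_replicate) simp
  then have "?u \<in> lists \<Sigma>" "0 < (1::nat)" "1 + l \<le> length ?u" "window l ?u 0 = window l ?u 1"
    using assms(2) by (auto simp: window_def)
  then show ?thesis
    using assms(1) unfolding hits_cycles_def by blast
qed

theorem theorem6p1:
  fixes k m :: nat and \<Sigma> :: "'a set"
  assumes "k \<ge> 2" and "m \<ge> 1" and "finite \<Sigma>" and "card \<Sigma> = m"
  shows "(\<lambda>n::nat. real (card (singleton_classes \<Sigma> k n)))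
           \<in> O(\<lambda>n. real n powr (necklace_number m (k - 1) - 1))"
proof -
  define l where "l = k - 1"
  have l: "0 < l" "k = Suc l"
    unfolding l_def using assms(1) by auto
  let ?W = "{w \<in> lists \<Sigma>. length w = l}"
  obtain S where S: "S \<subseteq> ?W" "inj_on rotations S" "hits_cycles \<Sigma> l S"
    using necklace_transversal[OF assms(3) l(1)] by blast
  have "\<Sigma> \<noteq> {}" using assms by auto
  then obtain s0 where s0: "s0 \<in> S"
    using hits_cycles_nonempty[OF S(3)] by blast
  obtain K where K: "\<And>n. l \<le> n \<Longrightarrow> card (singleton_words \<Sigma> (Suc l) n) \<le> K * (n + 1) ^ (card S - 1)"
    using card_singleton_words_le[OF assms(3) l(1) S(3,1) s0] by blast
  have finS: "finite S"
    by (rule finite_subset[OF S(1) finite_words[OF assms(3)]])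
  have "card S = card (rotations ` S)"
    using S(2) by (simp add: card_image)
  also have "\<dots> \<le> card (rotations ` ?W)"
    using S(1) assms(3) by (intro card_mono finite_imageI finite_words image_mono)
  finally have N: "real (card S) \<le> necklace_number m l"
    using card_necklaces[OF assms(3) l(1)] assms(4) by simp
  have pos: "card S \<ge> 1"
    using card_mono[OF finS, of "{s0}"] s0 by simp
  have "eventually (\<lambda>n. norm (real (card (singleton_classes \<Sigma> k n)))
      \<le> real (K * 2 ^ (card S - 1)) * norm (real n powr (necklace_number m l - 1))) at_top"
    using eventually_ge_at_top[of l]
  proof eventually_elim
    case (elim n)
    then have n: "n \<ge> 1" using l by simp
    have "card (singleton_classes \<Sigma> k n) \<le> K * (n + 1) ^ (card S - 1)"
      using card_singleton_classes_le[OF assms(3), of k n] K[OF elim] l(2) by simp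
    also have "\<dots> \<le> K * (2 * n) ^ (card S - 1)"
      using n by (intro mult_left_mono power_mono) auto
    finally have "real (card (singleton_classes \<Sigma> k n)) \<le> real (K * (2 * n) ^ (card S - 1))"
      by (simp only: of_nat_le_iff)
    also have "\<dots> = real (K * 2 ^ (card S - 1)) * real n powr real (card S - 1)"
      using n by (simp add: power_mult_distrib powr_realpow)
    also have "real n powr real (card S - 1) \<le> real n powr (necklace_number m l - 1)"
      using n N pos by (intro powr_mono) (simp_all add: of_nat_diff)
    finally show ?case
      by (simp add: mult_left_mono)
  qed
  then show ?thesis
    unfolding l_def by (rule bigoI)
qed

end
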